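(* Let $r=(r_n)_{n\ge 0}$ and $s=(s_n)_{n\ge 0}$ be two monotonic increasing, unbounded sequences of positive real numbers, and let $a=(a_n)_{n\ge0}$ be a complex sequence with $a_0\neq 0$ and $a_1\neq 0$. Then $T_a: h_r\to h_s$ is bounded (i.e. the convolution operator $T_a$ maps $h_r$ into $h_s$ and is a bounded linear operator) if and only if $$\lim_{n\to\infty} a_n=0 \quad\text{and}\quad \sup_{m\ge 0}\ \frac{1}{r_m}\sum_{n=0}^{\infty}s_n\,|a_{n-m}-a_{n+1}|<\infty,$$ where $a_k=0$ for $k<0$. In this case the operator norm is $$\|T_a\|_{\mathcal B(h_r,h_s)}=\sup_{m\ge 0}\ \frac{1}{r_m}\sum_{n=0}^{\infty}s_n\,|a_{n-m}-a_{n+1}|.$$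
   Context: All sequences are complex and indexed by $\mathbb N_0=\{0,1,2,\dots\}$. For a monotonic increasing, unbounded sequence $d=(d_n)$ of positive reals, the weighted Hahn space is $h_d=\{x\in\mathbb C^{\mathbb N_0}:\sum_{n=0}^\infty d_n|x_n-x_{n+1}|<\infty,\ \lim_n x_n=0\}$ with norm $\|x\|_{h_d}=\sum_{n=0}^\infty d_n|x_n-x_{n+1}|$; it is a Banach space. The convolution of sequences is $(a*x)_n=\sum_{k=0}^n a_{n-k}x_k$, and $T_a(x)=a*x$. The paper's convolution operators are defined for sequences $a$ with $a_0,a_1\ne0$. $\mathcal B(X,Y)$ is the space of bounded linear operators from $X$ to $Y$ with the operator norm. *)

theory Defs
  imports "HOL-Analysis.Analysis"
begin

definition hahn_weight :: "(nat \<Rightarrow> real) \<Rightarrow> bool" where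
  "hahn_weight d \<longleftrightarrow> (\<forall>n. 0 < d n) \<and> incseq d \<and> \<not> bdd_above (range d)"

definition hahn_space :: "(nat \<Rightarrow> real) \<Rightarrow> (nat \<Rightarrow> complex) set" where
  "hahn_space d =
    {x. summable (\<lambda>n. d n * cmod (x n - x (Suc n))) \<and> x \<longlonglongrightarrow> 0}"

text \<open>Only meaningful on \<open>hahn_space d\<close>, where the series converges.\<close>
definition hahn_norm :: "(nat \<Rightarrow> real) \<Rightarrow> (nat \<Rightarrow> complex) \<Rightarrow> real" where
  "hahn_norm d x = (\<Sum>n. d n * cmod (x n - x (Suc n)))"

definition conv_op :: "(nat \<Rightarrow> complex) \<Rightarrow> (nat \<Rightarrow> complex) \<Rightarrow> nat \<Rightarrow> complex" where
  "conv_op a x = (\<lambda>n. \<Sum>k\<le>n. a (n - k) * x k)"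

text \<open>The spaces depend on the weight, which is a term, so they cannot be types of class
  \<open>real_normed_vector\<close>, and \<open>bounded_linear\<close> and \<open>onorm\<close> do not apply.  Bounded operators and
  their norms are therefore relativised to a carrier \<open>X\<close> or \<open>Y\<close> with norm \<open>p\<close> or \<open>q\<close>.\<close>
definition bounded_operator ::
  "(nat \<Rightarrow> complex) set \<Rightarrow> ((nat \<Rightarrow> complex) \<Rightarrow> real) \<Rightarrow>
   (nat \<Rightarrow> complex) set \<Rightarrow> ((nat \<Rightarrow> complex) \<Rightarrow> real) \<Rightarrow>
   ((nat \<Rightarrow> complex) \<Rightarrow> nat \<Rightarrow> complex) \<Rightarrow> bool" where
  "bounded_operator X p Y q T \<longleftrightarrow>
    (\<forall>x\<in>X. T x \<in> Y) \<and>
    (\<forall>x\<in>X. \<forall>y\<in>X. T (\<lambda>n. x n + y n) = (\<lambda>n. T x n + T y n)) \<and>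
    (\<forall>c. \<forall>x\<in>X. T (\<lambda>n. c * x n) = (\<lambda>n. c * T x n)) \<and>
    (\<exists>C. \<forall>x\<in>X. q (T x) \<le> C * p x)"

definition operator_norm ::
  "(nat \<Rightarrow> complex) set \<Rightarrow> ((nat \<Rightarrow> complex) \<Rightarrow> real) \<Rightarrow>
   ((nat \<Rightarrow> complex) \<Rightarrow> real) \<Rightarrow>
   ((nat \<Rightarrow> complex) \<Rightarrow> nat \<Rightarrow> complex) \<Rightarrow> real" where
  "operator_norm X p q T = Sup {q (T x) | x. x \<in> X \<and> p x \<le> 1}"

definition zero_ext :: "(nat \<Rightarrow> complex) \<Rightarrow> int \<Rightarrow> complex" where
  "zero_ext a k = (if k < 0 then 0 else a (nat k))"

text \<open>Taken in \<open>[0, \<infinity>]\<close>, so that divergence of an inner series or unboundedness in \<open>m\<close>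
  gives the value \<open>\<infinity>\<close>.\<close>
definition hahn_conv_sup ::
  "(nat \<Rightarrow> real) \<Rightarrow> (nat \<Rightarrow> real) \<Rightarrow> (nat \<Rightarrow> complex) \<Rightarrow> ennreal" where
  "hahn_conv_sup r s a =
    (SUP m. ennreal (1 / r m) *
      (\<Sum>n. ennreal (s n * cmod (zero_ext a (int n - int m) - zero_ext a (int n + 1)))))"

end

theory Submission imports Defs begin

text \<open>The initial indicators \<open>b\<^sub>m = 1\<^bsub>{0..m}\<^esub>\<close> satisfy \<open>\<parallel>b\<^sub>m\<parallel> = r\<^sub>m\<close>, and every null sequence is
  \<open>x = \<Sum>\<^sub>m (x\<^sub>m - x\<^sub>m\<^sub>+\<^sub>1) b\<^sub>m\<close> coordinatewise, so \<open>\<parallel>x\<parallel>\<close> is the sum of the norms of the terms.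
  Hence the norm of an operator is the supremum of \<open>\<parallel>T b\<^sub>m\<parallel> / r\<^sub>m\<close>, as in \<open>\<ell>\<^sup>1\<close>; and
  \<open>T\<^sub>a b\<^sub>m\<close> has the differences \<open>a\<^sub>n\<^sub>-\<^sub>m - a\<^sub>n\<^sub>+\<^sub>1\<close>. That \<open>T\<^sub>a x\<close> is a null sequence follows from
  \<open>s\<^sub>n \<bar>y\<^sub>n\<bar> \<le> \<parallel>y\<parallel>\<close>, applied to \<open>y = T\<^sub>a b\<^sub>m\<close>, and the unboundedness of \<open>s\<close>.\<close>

definition initial_indicator :: "nat \<Rightarrow> nat \<Rightarrow> complex" where
  "initial_indicator m n = of_bool (n \<le> m)"

text \<open>With values in [0, \<infinity>] the norm makes sense for every sequence: membership
  becomes a finiteness condition, and series can be compared and interchanged before convergence is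
  known.\<close>

definition hahn_ennorm :: "(nat \<Rightarrow> real) \<Rightarrow> (nat \<Rightarrow> complex) \<Rightarrow> ennreal" where
  "hahn_ennorm d x = (\<Sum>n. ennreal (d n * cmod (x n - x (Suc n))))"

section \<open>Series with values in [0, \<infinity>]\<close>

text \<open>Tonelli's theorem for counting measure.\<close>

lemma suminf_ennreal_swap:
  fixes f :: "nat \<Rightarrow> nat \<Rightarrow> ennreal"
  shows "(\<Sum>i. \<Sum>j. f i j) = (\<Sum>j. \<Sum>i. f i j)"
proof -
  have "(\<Sum>i. \<Sum>j. f i j) = (\<integral>\<^sup>+i. (\<Sum>j. f i j) \<partial>count_space UNIV)"
    by (simp add: nn_integral_count_space_nat)
  also have "\<dots> = (\<Sum>j. \<integral>\<^sup>+i. f i j \<partial>count_space UNIV)"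
    by (rule nn_integral_suminf) simp
  finally show ?thesis
    by (simp add: nn_integral_count_space_nat)
qed

text \<open>Without absolute convergence the right side is \<open>top\<close>. That case must be
  allowed, since the telescoping expansion of a null sequence need not converge absolutely.\<close>

lemma ennreal_norm_sums_le:
  fixes f :: "nat \<Rightarrow> 'a :: banach"
  assumes "f sums S"
  shows "ennreal (norm S) \<le> (\<Sum>n. ennreal (norm (f n)))"
proof (cases "(\<Sum>n. ennreal (norm (f n))) = top")
  case False
  then have sm: "summable (\<lambda>n. norm (f n))"
    by (intro summable_suminf_not_top) auto
  have "norm S \<le> (\<Sum>n. norm (f n))"
    using summable_norm[OF sm] sums_unique[OF assms] by simp
  then show ?thesis
    using sm by (subst suminf_ennreal2) (auto intro: ennreal_leI)
qed simp

section \<open>Weights and Hahn spaces\<close>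

lemma hahn_weight_pos: "hahn_weight d \<Longrightarrow> 0 < d n"
  by (simp add: hahn_weight_def)

lemma hahn_weight_nonneg: "hahn_weight d \<Longrightarrow> 0 \<le> d n"
  by (simp add: hahn_weight_pos less_imp_le)

lemma hahn_weight_at_top:
  assumes "hahn_weight d"
  shows "filterlim d at_top sequentially"
  unfolding filterlim_at_top
proof
  fix Z
  have "incseq d" and "\<not> (\<forall>n. d n \<le> Z)"
    using assms by (auto simp: hahn_weight_def bdd_above_def)
  then obtain n where "Z < d n" by (auto simp: not_le)
  then have "Z \<le> d k" if "k \<ge> n" for k
    using incseqD[OF \<open>incseq d\<close> that] by linarith
  then show "\<forall>\<^sub>F n in sequentially. Z \<le> d n"
    by (auto simp: eventually_sequentially)
qed

lemma hahn_space_iff: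
  assumes "hahn_weight d"
  shows "x \<in> hahn_space d \<longleftrightarrow> x \<longlonglongrightarrow> 0 \<and> hahn_ennorm d x < \<infinity>"
proof -
  have nn: "0 \<le> d n * cmod (x n - x (Suc n))" for n
    by (simp add: hahn_weight_nonneg[OF assms])
  have "summable (\<lambda>n. d n * cmod (x n - x (Suc n))) \<longleftrightarrow> hahn_ennorm d x \<noteq> top"
    unfolding hahn_ennorm_def
    using summable_suminf_not_top[OF nn] ennreal_suminf_neq_top[OF _ nn] by auto
  then show ?thesis
    by (auto simp: hahn_space_def less_top)
qed

lemma hahn_ennorm_eq:
  assumes "hahn_weight d" "x \<in> hahn_space d"
  shows "hahn_ennorm d x = ennreal (hahn_norm d x)"
  using assms unfolding hahn_ennorm_def hahn_norm_def
  by (intro suminf_ennreal2) (auto simp: hahn_weight_nonneg hahn_space_def)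

lemma hahn_norm_nonneg:
  assumes "hahn_weight d" "x \<in> hahn_space d"
  shows "0 \<le> hahn_norm d x"
  using assms unfolding hahn_norm_def
  by (intro suminf_nonneg) (auto simp: hahn_weight_nonneg hahn_space_def)

lemma hahn_space_scale: "x \<in> hahn_space d \<Longrightarrow> (\<lambda>n. c * x n) \<in> hahn_space d"
  and hahn_norm_scale: "x \<in> hahn_space d \<Longrightarrow> hahn_norm d (\<lambda>n. c * x n) = cmod c * hahn_norm d x"
proof -
  assume x: "x \<in> hahn_space d"
  have eq: "d n * cmod (c * x n - c * x (Suc n)) = cmod c * (d n * cmod (x n - x (Suc n)))" for n
    by (simp add: norm_mult flip: right_diff_distrib)
  show "(\<lambda>n. c * x n) \<in> hahn_space d"
    using x by (auto simp: hahn_space_def eq intro!: summable_mult tendsto_mult_right_zero)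
  show "hahn_norm d (\<lambda>n. c * x n) = cmod c * hahn_norm d x"
    using x by (simp add: hahn_norm_def hahn_space_def eq suminf_mult)
qed

section \<open>Expansion in initial indicators\<close>

lemma initial_indicator_sums:
  "(\<lambda>n. d n * cmod (initial_indicator m n - initial_indicator m (Suc n))) sums d m"
proof -
  have "(\<lambda>n. d n * cmod (initial_indicator m n - initial_indicator m (Suc n)))
      = (\<lambda>n. if n = m then d n else 0)"
    by (auto simp: initial_indicator_def fun_eq_iff)
  then show ?thesis
    using sums_single[of m d] by simp
qed

lemma initial_indicator_in_hahn_space: "initial_indicator m \<in> hahn_space d"
proof -
  have "\<forall>\<^sub>F n in sequentially. initial_indicator m n = 0"
    using eventually_gt_at_top[of m]
    by eventually_elim (simp add: initial_indicator_def)
  then show ?thesis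
    using sums_summable[OF initial_indicator_sums] tendsto_eventually
    by (auto simp: hahn_space_def)
qed

lemma hahn_norm_initial_indicator: "hahn_norm d (initial_indicator m) = d m"
  unfolding hahn_norm_def using sums_unique[OF initial_indicator_sums] by simp

lemma initial_indicator_expansion:
  fixes x :: "nat \<Rightarrow> complex"
  assumes "x \<longlonglongrightarrow> 0"
  shows "(\<lambda>m. (x m - x (Suc m)) * initial_indicator m k) sums x k"
proof -
  \<comment> \<open>Terms with \<open>m < k\<close> vanish and the others telescope;
    \<open>max k n\<close> covers the range \<open>n \<le> k\<close>, where nothing has been added
    yet.\<close>
  have partial: "(\<Sum>m<n. (x m - x (Suc m)) * initial_indicator m k) = x k - x (max k n)" for n
    by (induction n) (auto simp: initial_indicator_def max_def le_Suc_eq not_le)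
  have "filterlim (\<lambda>n. max k n) sequentially sequentially"
    by (rule filterlim_at_top_mono[OF filterlim_ident]) simp
  then have "(\<lambda>n. x k - x (max k n)) \<longlonglongrightarrow> x k - 0"
    by (intro tendsto_intros filterlim_compose[OF assms])
  then show ?thesis
    by (simp add: sums_def partial)
qed

text \<open>Only differences with \<open>n \<le> m\<close> enter the expansion of
  \<open>y n\<close>, and there \<open>d n \<le> d m\<close>. The estimate turns a norm bound into
  decay of order \<open>1 / d n\<close>.\<close>

lemma weight_mult_norm_le_hahn_ennorm:
  assumes d: "hahn_weight d" and y: "y \<longlonglongrightarrow> 0"
  shows "ennreal (d n * cmod (y n)) \<le> hahn_ennorm d y"
proof -
  have "(\<lambda>m. of_real (d n) * ((y m - y (Suc m)) * initial_indicator m n)) sums (of_real (d n) * y n)"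
    by (intro sums_mult initial_indicator_expansion y)
  from ennreal_norm_sums_le[OF this]
  have "ennreal (d n * cmod (y n))
      \<le> (\<Sum>m. ennreal (d n * (cmod (y m - y (Suc m)) * cmod (initial_indicator m n))))"
    by (simp add: norm_mult abs_of_nonneg hahn_weight_nonneg[OF d])
  also have "\<dots> \<le> hahn_ennorm d y"
    unfolding hahn_ennorm_def
  proof (intro suminf_le ennreal_leI)
    fix m
    have "d n \<le> d m" if "n \<le> m"
      using d that by (auto simp: hahn_weight_def dest: incseqD)
    then show "d n * (cmod (y m - y (Suc m)) * cmod (initial_indicator m n))
        \<le> d m * cmod (y m - y (Suc m))"
      by (auto simp: initial_indicator_def hahn_weight_nonneg[OF d] intro: mult_right_mono)
  qed auto
  finally show ?thesis .
qed

section \<open>Convolution with initial indicators\<close>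

lemma conv_op_add: "conv_op a (\<lambda>n. x n + y n) = (\<lambda>n. conv_op a x n + conv_op a y n)"
  by (simp add: conv_op_def distrib_left sum.distrib)

lemma conv_op_scale: "conv_op a (\<lambda>n. c * x n) = (\<lambda>n. c * conv_op a x n)"
  by (simp add: conv_op_def sum_distrib_left mult.left_commute)

text \<open>Extension by zero keeps the range \<open>k \<le> m\<close> the same for every
  \<open>n\<close>, also for \<open>n < m\<close>, so that consecutive values are sums over shifted
  windows.\<close>

lemma conv_op_initial_indicator:
  "conv_op a (initial_indicator m) n = (\<Sum>k\<le>m. zero_ext a (int n - int k))"
proof -
  have "conv_op a (initial_indicator m) n = (\<Sum>k\<le>n. if k \<in> {..m} then a (n - k) else 0)"
    unfolding conv_op_def initial_indicator_def by (intro sum.cong) auto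
  also have "\<dots> = (\<Sum>k\<in>{..n} \<inter> {..m}. a (n - k))"
    by (rule sum.inter_restrict[symmetric]) simp
  also have "\<dots> = (\<Sum>k\<in>{..n} \<inter> {..m}. zero_ext a (int n - int k))"
    by (intro sum.cong) (auto simp: zero_ext_def nat_diff_distrib)
  also have "\<dots> = (\<Sum>k\<le>m. zero_ext a (int n - int k))"
    by (intro sum.mono_neutral_left) (auto simp: zero_ext_def)
  finally show ?thesis .
qed

text \<open>Passing from \<open>n\<close> to \<open>Suc n\<close> shifts the window by one, so only
  the two end terms survive.\<close>

lemma conv_op_initial_indicator_diff:
  "conv_op a (initial_indicator m) n - conv_op a (initial_indicator m) (Suc n)
    = zero_ext a (int n - int m) - zero_ext a (int n + 1)"
  unfolding conv_op_initial_indicator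
  by (induction m) (simp_all add: algebra_simps)

lemma conv_op_initial_indicator_null:
  assumes "a \<longlonglongrightarrow> 0"
  shows "conv_op a (initial_indicator m) \<longlonglongrightarrow> 0"
proof -
  have "(\<lambda>n. zero_ext a (int n - int k)) \<longlonglongrightarrow> 0" for k
  proof (rule LIMSEQ_offset)
    show "(\<lambda>n. zero_ext a (int (n + k) - int k)) \<longlonglongrightarrow> 0"
      using assms by (simp add: zero_ext_def)
  qed
  then have "(\<lambda>n. \<Sum>k\<le>m. zero_ext a (int n - int k)) \<longlonglongrightarrow> (\<Sum>k\<le>m. 0)"
    by (intro tendsto_sum)
  then show ?thesis
    by (simp flip: conv_op_initial_indicator)
qed

text \<open>This recovers \<open>a\<close> from the operator: if the image of this indicator lies in
  a Hahn space, then \<open>a\<close> is null.\<close>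

lemma conv_op_initial_indicator_0: "conv_op a (initial_indicator 0) = a"
  by (simp add: fun_eq_iff conv_op_initial_indicator zero_ext_def)

section \<open>Upper bound for the operator\<close>

text \<open>Each coordinate of \<open>conv_op a x\<close> is a finite combination of coordinates of
  \<open>x\<close>, so the coordinatewise expansion passes through the operator without any
  continuity.\<close>

lemma conv_op_expansion:
  assumes "x \<longlonglongrightarrow> 0"
  shows "(\<lambda>m. (x m - x (Suc m)) * conv_op a (initial_indicator m) n) sums conv_op a x n"
proof -
  have "(\<lambda>m. \<Sum>k\<le>n. a (n - k) * ((x m - x (Suc m)) * initial_indicator m k))
      sums (\<Sum>k\<le>n. a (n - k) * x k)"
    by (intro sums_sum sums_mult initial_indicator_expansion assms)
  then show ?thesis
    by (simp add: conv_op_def sum_distrib_left mult.left_commute)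
qed

lemma hahn_ennorm_conv_op_le:
  assumes d: "hahn_weight d" and x: "x \<longlonglongrightarrow> 0"
  shows "hahn_ennorm d (conv_op a x)
    \<le> (\<Sum>m. ennreal (cmod (x m - x (Suc m))) * hahn_ennorm d (conv_op a (initial_indicator m)))"
proof -
  let ?D = "\<lambda>m n. conv_op a (initial_indicator m) n - conv_op a (initial_indicator m) (Suc n)"
  have "ennreal (d n * cmod (conv_op a x n - conv_op a x (Suc n)))
      \<le> (\<Sum>m. ennreal (cmod (x m - x (Suc m))) * ennreal (d n * cmod (?D m n)))" for n
  proof -
    have "(\<lambda>m. of_real (d n) * ((x m - x (Suc m)) * ?D m n))
        sums (of_real (d n) * (conv_op a x n - conv_op a x (Suc n)))"
      \<comment> \<open>The instantiation splits only the products inside the series and leaves the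
        outer factor \<open>of_real (d n)\<close> undistributed.\<close>
      unfolding right_diff_distrib[of "x _ - x _"]
      by (intro sums_mult sums_diff conv_op_expansion x)
    from ennreal_norm_sums_le[OF this] show ?thesis
      by (simp add: norm_mult abs_of_nonneg hahn_weight_nonneg[OF d] mult.left_commute
          flip: ennreal_mult)
  qed
  then have "hahn_ennorm d (conv_op a x)
      \<le> (\<Sum>n. \<Sum>m. ennreal (cmod (x m - x (Suc m))) * ennreal (d n * cmod (?D m n)))"
    unfolding hahn_ennorm_def by (intro suminf_le) auto
  also have "\<dots> = (\<Sum>m. \<Sum>n. ennreal (cmod (x m - x (Suc m))) * ennreal (d n * cmod (?D m n)))"
    by (rule suminf_ennreal_swap)
  finally show ?thesis
    by (simp add: hahn_ennorm_def)
qed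

lemma hahn_conv_sup_eq:
  "hahn_conv_sup r s a =
    (SUP m. ennreal (1 / r m) * hahn_ennorm s (conv_op a (initial_indicator m)))"
  by (simp add: hahn_conv_sup_def hahn_ennorm_def conv_op_initial_indicator_diff)

lemma hahn_ennorm_conv_op_initial_indicator_le:
  assumes r: "hahn_weight r"
  shows "hahn_ennorm s (conv_op a (initial_indicator m)) \<le> ennreal (r m) * hahn_conv_sup r s a"
proof -
  have pos: "0 < r m" by (rule hahn_weight_pos[OF r])
  have "ennreal (r m) * (ennreal (1 / r m) * hahn_ennorm s (conv_op a (initial_indicator m)))
      \<le> ennreal (r m) * hahn_conv_sup r s a"
    unfolding hahn_conv_sup_eq by (intro mult_left_mono SUP_upper) auto
  moreover have "ennreal (r m) * ennreal (1 / r m) = 1"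
    using pos by (simp flip: ennreal_mult)
  ultimately show ?thesis
    by (simp flip: mult.assoc)
qed

text \<open>One estimate with two uses: \<open>f m\<close> is the full norm of the image of
  \<open>initial_indicator m\<close> when the norm of \<open>conv_op a x\<close> is bounded, and one
  weighted coordinate of that image when \<open>conv_op a x\<close> is shown to be null.\<close>

lemma suminf_diff_le_hahn_conv_sup:
  assumes r: "hahn_weight r"
    and f: "\<And>m. f m \<le> hahn_ennorm s (conv_op a (initial_indicator m))"
  shows "(\<Sum>m. ennreal (cmod (x m - x (Suc m))) * f m) \<le> hahn_conv_sup r s a * hahn_ennorm r x"
proof -
  have "(\<Sum>m. ennreal (cmod (x m - x (Suc m))) * f m)
      \<le> (\<Sum>m. ennreal (cmod (x m - x (Suc m))) * (ennreal (r m) * hahn_conv_sup r s a))"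
    by (intro suminf_le mult_left_mono order_trans[OF f]
        hahn_ennorm_conv_op_initial_indicator_le r) auto
  also have "\<dots> = (\<Sum>m. hahn_conv_sup r s a * ennreal (r m * cmod (x m - x (Suc m))))"
    by (simp add: ennreal_mult hahn_weight_nonneg[OF r] mult_ac)
  finally show ?thesis
    by (simp add: hahn_ennorm_def)
qed

text \<open>Finite norm alone gives convergence but not the limit 0: constant sequences have norm 0.
  Nullness is therefore proved separately.\<close>

lemma conv_op_null:
  assumes r: "hahn_weight r" and s: "hahn_weight s" and a: "a \<longlonglongrightarrow> 0"
    and fin: "hahn_conv_sup r s a < \<infinity>" and x: "x \<in> hahn_space r"
  shows "conv_op a x \<longlonglongrightarrow> 0"
proof -
  have x0: "x \<longlonglongrightarrow> 0" and "hahn_ennorm r x < \<infinity>"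
    using x hahn_space_iff[OF r] by auto
  then obtain K where K: "hahn_conv_sup r s a * hahn_ennorm r x = ennreal K" "0 \<le> K"
    using fin by (metis ennreal_cases ennreal_mult_eq_top_iff infinity_ennreal_def less_irrefl)
  have bound: "cmod (conv_op a x n) \<le> K / s n" for n
  proof -
    have "(\<lambda>m. of_real (s n) * ((x m - x (Suc m)) * conv_op a (initial_indicator m) n))
        sums (of_real (s n) * conv_op a x n)"
      by (intro sums_mult conv_op_expansion x0)
    from ennreal_norm_sums_le[OF this]
    have "ennreal (s n * cmod (conv_op a x n))
        \<le> (\<Sum>m. ennreal (cmod (x m - x (Suc m)))
                * ennreal (s n * cmod (conv_op a (initial_indicator m) n)))"
      by (simp add: norm_mult abs_of_nonneg hahn_weight_nonneg[OF s] mult.left_commute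
          flip: ennreal_mult)
    \<comment> \<open>The coordinate estimate is applied to the images of the indicators, already
      known to be null; applying it to \<open>conv_op a x\<close> itself would be circular.\<close>
    also have "\<dots> \<le> ennreal K"
      unfolding K(1)[symmetric]
      by (intro suminf_diff_le_hahn_conv_sup r weight_mult_norm_le_hahn_ennorm s
          conv_op_initial_indicator_null a)
    finally show ?thesis
      using K(2) hahn_weight_pos[OF s, of n] by (simp add: field_simps)
  qed
  have "(\<lambda>n. K / s n) \<longlonglongrightarrow> 0"
    by (intro real_tendsto_divide_at_top[OF tendsto_const] hahn_weight_at_top s)
  then show ?thesis
    by (rule Lim_null_comparison[rotated]) (simp add: bound)
qed

lemma conv_op_hahn_bound:
  assumes r: "hahn_weight r" and s: "hahn_weight s" and a: "a \<longlonglongrightarrow> 0"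
    and fin: "hahn_conv_sup r s a < \<infinity>" and x: "x \<in> hahn_space r"
  shows "conv_op a x \<in> hahn_space s"
    and "hahn_norm s (conv_op a x) \<le> enn2real (hahn_conv_sup r s a) * hahn_norm r x"
proof -
  have x0: "x \<longlonglongrightarrow> 0"
    using x hahn_space_iff[OF r] by auto
  have "hahn_ennorm s (conv_op a x) \<le> hahn_conv_sup r s a * hahn_ennorm r x"
    using hahn_ennorm_conv_op_le[OF s x0] suminf_diff_le_hahn_conv_sup[OF r order_refl]
    by (rule order_trans)
  \<comment> \<open>Finiteness matters here, because \<open>enn2real\<close> sends \<infinity> to
    0.\<close>
  also have "\<dots> = ennreal (enn2real (hahn_conv_sup r s a) * hahn_norm r x)"
    using fin by (simp add: hahn_ennorm_eq[OF r x] ennreal_mult hahn_norm_nonneg[OF r x])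
  finally have le: "hahn_ennorm s (conv_op a x)
      \<le> ennreal (enn2real (hahn_conv_sup r s a) * hahn_norm r x)" .
  then show mem: "conv_op a x \<in> hahn_space s"
    using conv_op_null[OF assms] by (auto simp: hahn_space_iff[OF s] intro: le_less_trans)
  show "hahn_norm s (conv_op a x) \<le> enn2real (hahn_conv_sup r s a) * hahn_norm r x"
    using le by (simp add: hahn_ennorm_eq[OF s mem] hahn_norm_nonneg[OF r x])
qed

section \<open>Lower bound, boundedness criterion and operator norm\<close>

text \<open>Testing on the indicators alone controls the supremum. \<open>C\<close> will be a
  constant bounding the operator, and later any upper bound of the image norms on the unit
  ball.\<close>

lemma hahn_conv_sup_le:
  assumes r: "hahn_weight r" and s: "hahn_weight s"
    and mem: "\<And>m. conv_op a (initial_indicator m) \<in> hahn_space s"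
    and le: "\<And>m. hahn_norm s (conv_op a (initial_indicator m)) \<le> C * r m"
  shows "hahn_conv_sup r s a \<le> ennreal C"
  unfolding hahn_conv_sup_eq
proof (rule SUP_least)
  fix m
  have "ennreal (1 / r m) * hahn_ennorm s (conv_op a (initial_indicator m))
      = ennreal (1 / r m * hahn_norm s (conv_op a (initial_indicator m)))"
    using hahn_weight_nonneg[OF r] hahn_norm_nonneg[OF s mem]
    by (simp add: hahn_ennorm_eq[OF s mem] flip: ennreal_mult)
  also have "\<dots> \<le> ennreal C"
    using le[of m] hahn_weight_pos[OF r, of m] by (intro ennreal_leI) (simp add: field_simps)
  finally show "ennreal (1 / r m) * hahn_ennorm s (conv_op a (initial_indicator m)) \<le> ennreal C" .
qed

lemma bounded_conv_op_iff:
  assumes r: "hahn_weight r" and s: "hahn_weight s"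
  shows "bounded_operator (hahn_space r) (hahn_norm r) (hahn_space s) (hahn_norm s) (conv_op a)
    \<longleftrightarrow> a \<longlonglongrightarrow> 0 \<and> hahn_conv_sup r s a < \<infinity>"
proof
  assume "bounded_operator (hahn_space r) (hahn_norm r) (hahn_space s) (hahn_norm s) (conv_op a)"
  then obtain C where mem: "\<And>x. x \<in> hahn_space r \<Longrightarrow> conv_op a x \<in> hahn_space s"
    and C: "\<And>x. x \<in> hahn_space r \<Longrightarrow> hahn_norm s (conv_op a x) \<le> C * hahn_norm r x"
    unfolding bounded_operator_def by blast
  have "a \<in> hahn_space s"
    using mem[OF initial_indicator_in_hahn_space[of 0]] by (simp add: conv_op_initial_indicator_0)
  moreover have "hahn_conv_sup r s a \<le> ennreal C"
    using mem C initial_indicator_in_hahn_space hahn_norm_initial_indicator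
    by (intro hahn_conv_sup_le r s) metis+
  ultimately show "a \<longlonglongrightarrow> 0 \<and> hahn_conv_sup r s a < \<infinity>"
    by (auto simp: hahn_space_def intro: le_less_trans)
next
  assume "a \<longlonglongrightarrow> 0 \<and> hahn_conv_sup r s a < \<infinity>"
  then show "bounded_operator (hahn_space r) (hahn_norm r) (hahn_space s) (hahn_norm s) (conv_op a)"
    using conv_op_hahn_bound[OF r s, of a] unfolding bounded_operator_def
    by (auto simp: conv_op_add conv_op_scale intro!: exI[of _ "enn2real (hahn_conv_sup r s a)"])
qed

lemma operator_norm_conv_op:
  assumes r: "hahn_weight r" and s: "hahn_weight s"
    and a: "a \<longlonglongrightarrow> 0" and fin: "hahn_conv_sup r s a < \<infinity>"
  shows "operator_norm (hahn_space r) (hahn_norm r) (hahn_norm s) (conv_op a)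
    = enn2real (hahn_conv_sup r s a)"
  unfolding operator_norm_def
proof (rule cSup_eq_non_empty)
  \<comment> \<open>The zero sequence is the witness; a real \<open>Sup\<close> is determined by its
    upper bounds only for a nonempty set.\<close>
  show "{hahn_norm s (conv_op a x) |x. x \<in> hahn_space r \<and> hahn_norm r x \<le> 1} \<noteq> {}"
    by (auto simp: hahn_space_def hahn_norm_def intro!: exI[of _ "\<lambda>_. 0"])
next
  fix y assume "y \<in> {hahn_norm s (conv_op a x) |x. x \<in> hahn_space r \<and> hahn_norm r x \<le> 1}"
  then obtain x where x: "x \<in> hahn_space r" "hahn_norm r x \<le> 1"
    and y: "y = hahn_norm s (conv_op a x)" by blast
  show "y \<le> enn2real (hahn_conv_sup r s a)"
    using conv_op_hahn_bound(2)[OF r s a fin x(1)]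
      mult_left_mono[OF x(2) enn2real_nonneg[of "hahn_conv_sup r s a"]]
    unfolding y by simp
next
  fix C
  assume ub: "\<And>y. y \<in> {hahn_norm s (conv_op a x) |x. x \<in> hahn_space r \<and> hahn_norm r x \<le> 1}
      \<Longrightarrow> y \<le> C"
  have mem: "conv_op a (initial_indicator m) \<in> hahn_space s" for m
    by (intro conv_op_hahn_bound[OF r s a fin] initial_indicator_in_hahn_space)
  have le: "hahn_norm s (conv_op a (initial_indicator m)) \<le> C * r m" for m
  proof -
    \<comment> \<open>Dividing the indicator by its norm \<open>r m\<close> gives a unit vector, to
      which \<open>ub\<close> applies.\<close>
    let ?c = "complex_of_real (1 / r m)" and ?b = "initial_indicator m"
    have pos: "0 < r m" by (rule hahn_weight_pos[OF r])
    have b: "(\<lambda>n. ?c * ?b n) \<in> hahn_space r"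
      by (rule hahn_space_scale[OF initial_indicator_in_hahn_space])
    have "hahn_norm r (\<lambda>n. ?c * ?b n) = 1"
      using pos
      by (subst hahn_norm_scale[OF initial_indicator_in_hahn_space])
        (simp add: hahn_norm_initial_indicator norm_divide)
    then have "hahn_norm s (conv_op a (\<lambda>n. ?c * ?b n)) \<le> C"
      using b by (intro ub) (metis (mono_tags, lifting) mem_Collect_eq order_refl)
    moreover have "hahn_norm s (conv_op a (\<lambda>n. ?c * ?b n)) = hahn_norm s (conv_op a ?b) / r m"
      unfolding conv_op_scale hahn_norm_scale[OF mem] using pos by (simp add: norm_divide)
    ultimately show ?thesis
      using pos by (simp only: pos_divide_le_eq)
  qed
  \<comment> \<open>The sign of \<open>C\<close> is needed to return to the reals:
    \<open>ennreal C\<close> is 0 for negative \<open>C\<close>.\<close>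
  have "0 \<le> C * r 0"
    using hahn_norm_nonneg[OF s mem] le by (rule order_trans)
  then have "0 \<le> C"
    using hahn_weight_pos[OF r, of 0] by (simp add: zero_le_mult_iff)
  then show "enn2real (hahn_conv_sup r s a) \<le> C"
    using hahn_conv_sup_le[OF r s mem le] by (intro enn2real_leI)
qed

theorem theorem4p3:
  fixes r s :: "nat \<Rightarrow> real" and a :: "nat \<Rightarrow> complex"
  assumes "hahn_weight r" and "hahn_weight s"
    and "a 0 \<noteq> 0" and "a 1 \<noteq> 0"
  shows "(bounded_operator (hahn_space r) (hahn_norm r) (hahn_space s) (hahn_norm s) (conv_op a)
            \<longleftrightarrow> a \<longlonglongrightarrow> 0 \<and> hahn_conv_sup r s a < \<infinity>)
       \<and> (bounded_operator (hahn_space r) (hahn_norm r) (hahn_space s) (hahn_norm s) (conv_op a)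
            \<longrightarrow> operator_norm (hahn_space r) (hahn_norm r) (hahn_norm s) (conv_op a)
                  = enn2real (hahn_conv_sup r s a))"
  using bounded_conv_op_iff[OF assms(1,2)] operator_norm_conv_op[OF assms(1,2)] by blast

end
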